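(* Let $m=p_{1}^{r_{1}}\cdots p_{k}^{r_{k}}$ be the prime factorization of an integer $m \ge 2$. For $1\le i\le k$, put $$d'_{i}=\begin{cases} \gcd\big(p_{i}^{r_{i}},\ 2\lambda(m)/\lambda(p_i^{r_i})\big) & \text{if } p_{i}=2 \text{ and } r_{i}= 2,\\ \gcd\big(p_{i}^{r_{i}},\ \lambda(m)/\lambda(p_i^{r_i})\big) & \text{otherwise}.\end{cases}$$ Let $d'=\prod_{i=1}^{k}d'_{i}$. Then the image of the homomorphism $$\phi_m:(\mathbb{Z}/m^{2}\mathbb{Z})^{*}\to (\mathbb{Z}/m\mathbb{Z},+),\qquad x\mapsto C_m(x) \bmod m,$$ is $d'\mathbb{Z}/m\mathbb{Z}$.
   Context: $\lambda$ denotes the Carmichael function: $\lambda(m)$ is the exponent of the multiplicative group $(\mathbb{Z}/m\mathbb{Z})^{*}$. For coprime integers $m\ge 2$ and $a$, the Carmichael quotient is the integer $C_{m}(a)=\frac{a^{\lambda(m)}-1}{m}$. The residue of $C_m(x)$ modulo $m$ depends only on $x$ modulo $m^2$, and $C_m(xy)\equiv C_m(x)+C_m(y)\pmod m$, so $\phi_m$ is a well-defined group homomorphism. *)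

theory Defs
  imports "HOL-Number_Theory.Number_Theory"
begin

text \<open>
  Carmichael's function is the library's \<^const>\<open>Carmichael\<close>: the least common multiple of the
  element orders of the multiplicative group modulo \<open>m\<close>, i.e. the exponent of that group.

  In the next definition the division is exact whenever \<open>m > 0\<close> and \<open>a\<close> is coprime
  to \<open>m\<close> (\<open>carmichael_quotient_times\<close> below).
\<close>

definition carmichael_quotient :: "nat \<Rightarrow> int \<Rightarrow> int" where
  "carmichael_quotient m a = (a ^ Carmichael m - 1) div int m"

lemma carmichael_quotient_times:
  assumes "m > 0" and "coprime a (int m)"
  shows "int m * carmichael_quotient m a = a ^ Carmichael m - 1"
proof -
  have "int m dvd a ^ Carmichael m - 1"
  proof -
    define b where "b = nat (a mod int m)"
    have b: "int b = a mod int m"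
      using assms(1) by (simp add: b_def)
    have "coprime (int b) (int m)"
      using assms by (simp add: b)
    then have "coprime m b"
      by (simp add: coprime_commute)
    then have "[b ^ Carmichael m = 1] (mod m)"
      by (intro Carmichael_divides) simp_all
    then have "[int b ^ Carmichael m = 1] (mod int m)"
      by (metis cong_int_iff of_nat_1 of_nat_power)
    moreover have "[int b ^ Carmichael m = a ^ Carmichael m] (mod int m)"
      by (intro cong_pow) (simp add: b)
    ultimately have "[a ^ Carmichael m = 1] (mod int m)"
      using cong_sym cong_trans by blast
    then show ?thesis
      by (simp add: cong_iff_dvd_diff)
  qed
  then show ?thesis
    by (simp add: carmichael_quotient_def)
qed

lemma carmichael_quotient_cong:
  assumes "m > 0" and "coprime a (int m)" and "[a = b] (mod (int m)\<^sup>2)"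
  shows "[carmichael_quotient m a = carmichael_quotient m b] (mod int m)"
proof -
  have "[a = b] (mod int m)"
    using assms(3) by (rule cong_dvd_modulus) simp
  then have b: "coprime b (int m)"
    using assms(2) cong_imp_coprime by blast
  have "[a ^ Carmichael m = b ^ Carmichael m] (mod (int m)\<^sup>2)"
    using assms(3) by (rule cong_pow)
  then have "(int m)\<^sup>2 dvd (a ^ Carmichael m - 1) - (b ^ Carmichael m - 1)"
    by (simp add: cong_iff_dvd_diff)
  also have "(a ^ Carmichael m - 1) - (b ^ Carmichael m - 1) =
      int m * (carmichael_quotient m a - carmichael_quotient m b)"
    using carmichael_quotient_times[OF assms(1,2)] carmichael_quotient_times[OF assms(1) b]
    by (simp add: right_diff_distrib)
  finally show ?thesis
    using assms(1) by (simp add: cong_iff_dvd_diff power2_eq_square)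
qed

lemma carmichael_quotient_mult:
  assumes "m > 0" and "coprime a (int m)" and "coprime b (int m)"
  shows "[carmichael_quotient m (a * b) = carmichael_quotient m a + carmichael_quotient m b]
    (mod int m)"
proof -
  let ?C = "carmichael_quotient m"
  have ab: "coprime (a * b) (int m)"
    using assms by simp
  have A: "a ^ Carmichael m = 1 + int m * ?C a" and B: "b ^ Carmichael m = 1 + int m * ?C b"
    using carmichael_quotient_times assms by simp_all
  have "int m * ?C (a * b) = a ^ Carmichael m * b ^ Carmichael m - 1"
    using carmichael_quotient_times[OF assms(1) ab] by (simp add: power_mult_distrib)
  also have "\<dots> = int m * (?C a + ?C b + int m * (?C a * ?C b))"
    unfolding A B by (simp add: algebra_simps)
  finally have "?C (a * b) = ?C a + ?C b + int m * (?C a * ?C b)"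
    using assms(1) by simp
  then show ?thesis
    by (simp add: cong_def)
qed

text \<open>
  A residue class is represented by its least nonnegative element, as in \<^const>\<open>residue_ring\<close>.
  The value on a unit class modulo \<open>m\<^sup>2\<close> does not depend on the representative, by
  \<open>carmichael_quotient_cong\<close>.
\<close>

definition carmichael_hom :: "nat \<Rightarrow> int \<Rightarrow> int" where
  "carmichael_hom m x = carmichael_quotient m x mod int m"

lemma carmichael_hom_in_hom:
  assumes "m \<ge> 2"
  shows "carmichael_hom m \<in>
    hom (units_of (residue_ring ((int m)\<^sup>2))) (add_monoid (residue_ring (int m)))"
proof -
  interpret R: residues "(int m)\<^sup>2" "residue_ring ((int m)\<^sup>2)"
    using assms by unfold_locales (simp_all add: one_less_power)
  have *: "carmichael_hom m (x * y mod (int m)\<^sup>2) = (carmichael_hom m x + carmichael_hom m y) mod int m"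
    if "coprime x (int m)" "coprime y (int m)" for x y
  proof -
    have "[carmichael_quotient m (x * y) = carmichael_quotient m (x * y mod (int m)\<^sup>2)] (mod int m)"
      using that assms by (intro carmichael_quotient_cong) (auto simp: cong_def)
    with carmichael_quotient_mult[of m x y] that assms show ?thesis
      by (simp add: carmichael_hom_def cong_def mod_add_eq)
  qed
  show ?thesis
    using assms
    by (auto simp: hom_def units_of_def R.res_units_eq *)
      (auto simp: residue_ring_def carmichael_hom_def *[unfolded carmichael_hom_def])
qed

text \<open>
  For a prime divisor \<open>p\<close> of \<open>m\<close>, \<open>multiplicity p m\<close> is the exponent \<open>r\<close> of \<open>p\<close> in the prime
  factorization of \<open>m\<close>. The divisions are exact, by \<open>Carmichael_multiplicity_dvd\<close> below.
\<close>

definition image_gen_factor :: "nat \<Rightarrow> nat \<Rightarrow> nat" where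
  "image_gen_factor m p =
    (let r = multiplicity p m in
     if p = 2 \<and> r = 2 then gcd (p ^ r) (2 * Carmichael m div Carmichael (p ^ r))
     else gcd (p ^ r) (Carmichael m div Carmichael (p ^ r)))"

definition image_gen :: "nat \<Rightarrow> nat" where
  "image_gen m = (\<Prod>p\<in>prime_factors m. image_gen_factor m p)"

lemma Carmichael_multiplicity_dvd:
  assumes "m > 0" and "prime p"
  shows "Carmichael (p ^ multiplicity p m) dvd Carmichael m"
proof -
  obtain n where n: "m = p ^ multiplicity p m * n" "\<not> p dvd n"
    using assms multiplicity_decompose'[of m p] by (metis not_gr_zero not_prime_unit)
  then have "coprime (p ^ multiplicity p m) n"
    using assms(2) by (simp add: prime_imp_coprime)
  then show ?thesis
    using n(1) Carmichael_mult_coprime by (metis dvd_lcm1)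
qed

end

theory Submission
  imports Defs
begin

text \<open>
  For a prime power \<open>q = p ^ r\<close> exactly dividing \<open>m = q * n\<close>, put
  \<open>t = \<lambda>(m) div \<lambda>(q)\<close>. Expanding \<open>a ^ \<lambda>(m) = (1 + q * C\<^sub>q(a)) ^ t\<close> modulo \<open>q\<^sup>2\<close>
  gives \<open>n * C\<^sub>m(a) \<equiv> t * C\<^sub>q(a)\<close> modulo \<open>q\<close>, so up to units everything is governed by \<open>C\<^sub>q\<close>.
  By lifting the exponent, \<open>C\<^sub>q\<close> takes a unit value at \<open>1 + p\<close> (at \<open>5\<close> if \<open>8\<close> divides \<open>q\<close>), except
  for \<open>q = 4\<close>, where all its values are even and \<open>2\<close> is taken. The Chinese remainder theorem glues
  these points to one \<open>x\<close> with \<open>gcd(C\<^sub>m(x), m) = d'\<close>, and the powers of \<open>x\<close>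
  then reach every multiple of \<open>d'\<close>.
\<close>

section \<open>Gcds with products of coprime moduli\<close>

text \<open>\<open>d\<close> divides both \<open>t * q\<close> and \<open>t * c\<close>, hence their
  gcd. This lets \<open>c\<close> be traded for \<open>gcd q c\<close> under divisors of
  \<open>q\<close>.\<close>

lemma dvd_gcd_mult_int:
  fixes d t c q :: int
  assumes "d dvd q" and "d dvd t * c"
  shows "d dvd gcd q c * t"
proof -
  have "d dvd gcd (t * q) (t * c)"
    using assms by simp
  also have "\<dots> = \<bar>t\<bar> * gcd q c"
    by (rule gcd_mult_distrib_int [symmetric])
  also have "\<dots> dvd gcd q c * t"
    by (simp add: mult.commute[of t])
  finally show ?thesis .
qed

lemma gcd_mult_coprime_int:
  fixes a b c :: int
  assumes "coprime a b"
  shows "gcd c (a * b) = gcd c a * gcd c b"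
proof (rule zdvd_antisym_nonneg)
  \<comment> \<open>Two applications of the trade, first on \<open>b\<close>, then on
    \<open>a\<close>; coprimality serves only the reverse divisibility.\<close>
  have "gcd c (a * b) dvd gcd c b * a"
    by (intro dvd_gcd_mult_int) auto
  then show "gcd c (a * b) dvd gcd c a * gcd c b"
    by (intro dvd_gcd_mult_int) auto
  have "coprime (gcd c a) (gcd c b)"
    using assms by (meson coprime_divisors gcd_dvd2)
  then show "gcd c a * gcd c b dvd gcd c (a * b)"
    by (simp add: divides_mult mult_dvd_mono)
qed simp_all

lemma gcd_prod_coprime_int:
  fixes f :: "'a \<Rightarrow> int"
  assumes "finite A" and "\<And>i j. i \<in> A \<Longrightarrow> j \<in> A \<Longrightarrow> i \<noteq> j \<Longrightarrow> coprime (f i) (f j)"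
  shows "gcd c (\<Prod>i\<in>A. f i) = (\<Prod>i\<in>A. gcd c (f i))"
  using assms
proof (induction A rule: finite_induct)
  case (insert i A)
  then have "coprime (f i) (\<Prod>j\<in>A. f j)"
    by (intro prod_coprime_right) auto
  with insert show ?case
    by (simp add: gcd_mult_coprime_int)
qed simp

section \<open>Lifting the exponent\<close>

lemma power_one_plus_cong:
  fixes y :: int
  shows "[(1 + y) ^ n = 1 + int n * y] (mod y\<^sup>2)"
proof (induction n)
  case (Suc n)
  have "[(1 + y) * (1 + y) ^ n = (1 + y) * (1 + int n * y)] (mod y\<^sup>2)"
    by (intro cong_mult Suc cong_refl)
  also have "(1 + y) * (1 + int n * y) = 1 + int (Suc n) * y + int n * y\<^sup>2"
    by (simp add: algebra_simps power2_eq_square)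
  also have "[\<dots> = 1 + int (Suc n) * y] (mod y\<^sup>2)"
    by (simp add: cong_def)
  finally show ?case
    by simp
qed simp

text \<open>A \<open>p\<close>-th power raises the valuation of the distance to 1 by exactly one:
  \<open>(1 + y) ^ p - 1\<close> is \<open>y\<close> times a geometric sum, and that sum is
  \<open>p\<close> times a number that is 1 modulo \<open>p\<close>.\<close>

lemma power_prime_one_plus:
  fixes c :: int
  assumes "prime p" and "s > 0" and "p = 2 \<Longrightarrow> s \<ge> 2" and "\<not> int p dvd c"
  obtains c' where "(1 + int p ^ s * c) ^ p = 1 + int p ^ Suc s * c'" "\<not> int p dvd c'"
proof -
  define y where "y = int p ^ s * c"
  have py: "int p dvd y"
    using assms(2) by (simp add: y_def)
  \<comment> \<open>Modulo \<open>p^2\<close> the geometric sum is \<open>p\<close> plus this term,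
    which has to vanish. For \<open>p = 2\<close> the sum of the \<open>i\<close> is 1, so
    \<open>y\<close> alone must supply \<open>p^2\<close>, whence \<open>s \<ge> 2\<close>; for odd
    \<open>p\<close> both factors supply a \<open>p\<close>.\<close>
  have "(int p)\<^sup>2 dvd y * (\<Sum>i<p. int i)"
  proof (cases "p = 2")
    case True
    then have "(int p)\<^sup>2 dvd int p ^ s"
      using assms(3) by (intro le_imp_power_dvd) simp
    then show ?thesis
      by (simp add: y_def)
  next
    case False
    have "2 * (\<Sum>i<p. int i) = int p * int (p - 1)"
      using prime_gt_0_nat[OF assms(1)] 
      by (induction p rule: nat_induct_non_zero) (auto simp: algebra_simps of_nat_diff)
    then have "int p dvd 2 * (\<Sum>i<p. int i)"
      by simp
    moreover have "coprime (int p) 2"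
      using assms(1) False primes_coprime[of p 2] by (metis coprime_int_iff of_nat_numeral two_is_prime_nat)
    ultimately have "int p dvd (\<Sum>i<p. int i)"
      by (simp add: coprime_dvd_mult_right_iff)
    with py show ?thesis
      by (simp add: power2_eq_square mult_dvd_mono)
  qed
  moreover have "(\<Sum>i<p. 1 + int i * y) = int p + y * (\<Sum>i<p. int i)"
    by (simp add: sum.distrib sum_distrib_left mult.commute)
  moreover have "[(\<Sum>i<p. (1 + y) ^ i) = (\<Sum>i<p. 1 + int i * y)] (mod (int p)\<^sup>2)"
    using py
    by (intro cong_sum cong_dvd_modulus[OF power_one_plus_cong] dvd_power_same)
  ultimately have "[(\<Sum>i<p. (1 + y) ^ i) = int p] (mod (int p)\<^sup>2)"
    by (metis cong_add_lcancel_0 cong_0_iff cong_trans)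
  then obtain k where "(\<Sum>i<p. (1 + y) ^ i) - int p = (int p)\<^sup>2 * k"
    by (auto simp: cong_iff_dvd_diff)
  then have k: "(\<Sum>i<p. (1 + y) ^ i) = int p * (1 + int p * k)"
    by (simp add: algebra_simps power2_eq_square)
  have "(1 + y) ^ p - 1 = y * (\<Sum>i<p. (1 + y) ^ i)"
    using power_diff_1_eq[of "1 + y" p] by simp
  then have "(1 + y) ^ p = 1 + int p ^ Suc s * (c * (1 + int p * k))"
    unfolding k by (simp add: y_def algebra_simps)
  moreover have "\<not> int p dvd 1 + int p * k"
    using assms(1) by (metis dvd_add_left_iff dvd_triv_left int_dvd_int_iff of_nat_1 not_prime_unit)
  then have "\<not> int p dvd c * (1 + int p * k)"
    using assms(1,4) by (simp add: prime_dvd_mult_iff)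
  ultimately show ?thesis
    using that y_def by blast
qed

text \<open>Each of the \<open>k\<close> successive \<open>p\<close>-th powers adds one to the
  valuation. The remaining exponent \<open>n\<close> only contributes a geometric sum that is
  \<open>n\<close> modulo \<open>p\<close>, so it leaves the valuation unchanged.\<close>

lemma power_one_plus_prime_power:
  fixes p s k n :: nat
  assumes "prime p" and "s > 0" and "p = 2 \<Longrightarrow> s \<ge> 2" and "\<not> p dvd n"
  obtains c where "(1 + int p ^ s) ^ (p ^ k * n) = 1 + int p ^ (s + k) * c" "\<not> int p dvd c"
proof -
  have "\<exists>c. (1 + int p ^ s) ^ (p ^ k) = 1 + int p ^ (s + k) * c \<and> \<not> int p dvd c"
  proof (induction k)
    case 0
    have "\<not> int p dvd 1"
      using assms(1) by (metis int_dvd_int_iff of_nat_1 not_prime_unit)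
    then show ?case
      by (auto intro: exI[of _ 1])
  next
    case (Suc k)
    then obtain c where c: "(1 + int p ^ s) ^ (p ^ k) = 1 + int p ^ (s + k) * c" "\<not> int p dvd c"
      by blast
    obtain c' where "(1 + int p ^ (s + k) * c) ^ p = 1 + int p ^ Suc (s + k) * c'" "\<not> int p dvd c'"
      using assms c(2) by (elim power_prime_one_plus[of p "s + k" c, rotated 4]) auto
    moreover have "(1 + int p ^ s) ^ (p ^ Suc k) = ((1 + int p ^ s) ^ (p ^ k)) ^ p"
      by (simp add: power_mult mult.commute flip: power_mult)
    ultimately show ?case
      using c(1) by auto
  qed
  then obtain c where c: "(1 + int p ^ s) ^ (p ^ k) = 1 + int p ^ (s + k) * c" "\<not> int p dvd c"
    by blast
  define y where "y = int p ^ (s + k) * c"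
  define S where "S = (\<Sum>i<n. (1 + y) ^ i)"
  have "int p dvd y"
    using assms(2) by (simp add: y_def)
  then have "[1 + y = 1] (mod int p)"
    by (simp add: cong_iff_dvd_diff)
  then have "[S = (\<Sum>i<n. 1 ^ i)] (mod int p)"
    unfolding S_def by (intro cong_sum cong_pow)
  then have "[S = int n] (mod int p)"
    by simp
  then have "\<not> int p dvd S"
    using assms(4) by (metis cong_dvd_iff int_dvd_int_iff)
  then have "\<not> int p dvd c * S"
    using assms(1) c(2) by (simp add: prime_dvd_mult_iff)
  moreover have "(1 + y) ^ n - 1 = y * S"
    using power_diff_1_eq[of "1 + y" n] by (simp add: S_def)
  then have "(1 + int p ^ s) ^ (p ^ k * n) = 1 + int p ^ (s + k) * (c * S)"
    by (simp add: power_mult c(1) y_def mult.assoc)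
  ultimately show ?thesis
    using that by blast
qed

section \<open>Carmichael quotients modulo prime powers\<close>

text \<open>For \<open>r > 0\<close> this generates the image of the homomorphism for the modulus
  \<open>p ^ r\<close>; the next two lemmas give the two halves.\<close>

definition prime_power_image_gen :: "nat \<Rightarrow> nat \<Rightarrow> nat" where
  "prime_power_image_gen p r = (if p = 2 \<and> r = 2 then 2 else 1)"

text \<open>Only modulus 4 has content: odd squares are 1 modulo 8, so \<open>a\<^sup>2 - 1\<close>
  has a factor 2 to spare.\<close>

lemma prime_power_image_gen_dvd:
  assumes "prime p" and "coprime a (int p)"
  shows "int (prime_power_image_gen p r) dvd carmichael_quotient (p ^ r) a"
proof (cases "p = 2 \<and> r = 2")
  case True
  then have "odd a"
    using assms(2) by (metis coprime_right_2_iff_odd of_nat_numeral)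
  then obtain b where b: "a = 2 * b + 1"
    by (elim oddE)
  have "even (b * (b + 1))"
    by simp
  then obtain d where "b * (b + 1) = 2 * d"
    by (elim evenE)
  then have "a\<^sup>2 - 1 = 4 * (2 * d)"
    by (simp add: b power2_eq_square algebra_simps)
  then have "carmichael_quotient 4 a = 2 * d"
    by (simp add: carmichael_quotient_def)
  with True show ?thesis
    by (simp add: prime_power_image_gen_def)
qed (auto simp: prime_power_image_gen_def)

lemma prime_power_image_gen_attained:
  assumes "prime p" and "r > 0"
  obtains a :: nat where "coprime a p"
    and "gcd (int p ^ r) (carmichael_quotient (p ^ r) (int a)) = int (prime_power_image_gen p r)"
proof -
  have p: "p > 1"
    using assms(1) prime_gt_1_nat by blast
  \<comment> \<open>If the valuation of \<open>a ^ Carmichael (p ^ r) - 1\<close> is exactly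
    \<open>r\<close>, the quotient is prime to \<open>p\<close>.\<close>
  have unit: "gcd (int p ^ r) (carmichael_quotient (p ^ r) a) = 1"
    if "a ^ Carmichael (p ^ r) = 1 + int p ^ r * c" "\<not> int p dvd c" for a c
  proof -
    have "carmichael_quotient (p ^ r) a = c"
      using that(1) p by (simp add: carmichael_quotient_def)
    moreover have "coprime (int p) c"
      using assms(1) that(2) by (intro prime_imp_coprime) auto
    ultimately show ?thesis
      by simp
  qed
  consider "p \<noteq> 2" | "p = 2" "r = 1" | "p = 2" "r = 2" | "p = 2" "r \<ge> 3"
    using assms(2) by linarith
  then show ?thesis
  proof cases
    case 1
    have "\<not> p dvd p - 1"
      using p by (simp add: nat_dvd_not_less)
    then obtain c where c: "(1 + int p ^ 1) ^ (p ^ (r - 1) * (p - 1)) = 1 + int p ^ (1 + (r - 1)) * c"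
      "\<not> int p dvd c"
      using assms 1 by (elim power_one_plus_prime_power[of p 1 "p - 1" "r - 1", rotated 4]) auto
    have "(1 + int p) ^ Carmichael (p ^ r) = 1 + int p ^ r * c"
      using c(1) 1 assms by (simp add: Carmichael_prime_power)
    from unit[OF this c(2)] show ?thesis
      using 1 by (intro that[of "1 + p"]) (simp_all add: prime_power_image_gen_def)
  next
    case 2
    have "(3 :: int) ^ Carmichael (p ^ r) = 1 + int p ^ r * 1"
      using 2 by simp
    from unit[OF this] show ?thesis
      using 2 by (intro that[of 3]) (simp_all add: prime_power_image_gen_def)
  next
    case 3
    have "carmichael_quotient 4 5 = 6"
      by (simp add: carmichael_quotient_def)
    moreover have "gcd (4 :: int) 6 = 2"
      by (simp add: gcd_non_0_int)
    ultimately show ?thesis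
      using 3 by (intro that[of 5]) (simp_all add: prime_power_image_gen_def)
  next
    case 4
    \<comment> \<open>Here \<lambda> is \<open>2 ^ (r - 2)\<close>; starting from
      \<open>5 = 1 + 2 ^ 2\<close> gives valuation \<open>2 + (r - 2) = r\<close>.\<close>
    obtain c where c: "(1 + int 2 ^ 2) ^ (2 ^ (r - 2) * 1) = 1 + int 2 ^ (2 + (r - 2)) * c"
      "\<not> int 2 dvd c"
      by (elim power_one_plus_prime_power[of 2 2 1 "r - 2", rotated 4]) auto
    have "2 + (r - 2) = r"
      using 4 by simp
    with c(1) have "5 ^ Carmichael (p ^ r) = 1 + int p ^ r * c"
      using 4 by (simp only:) (simp add: Carmichael_twopow)
    from unit[OF this] c(2) 4 show ?thesis
      by (intro that[of 5]) (simp_all add: prime_power_image_gen_def)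
  qed
qed

section \<open>From a prime power divisor to \<open>m\<close>\<close>

text \<open>Unifies the two cases of the definition: the extra 2 there is the local generator for
  modulus 4.\<close>

lemma image_gen_factor_eq:
  assumes "m > 0" and "prime p"
  defines "q \<equiv> p ^ multiplicity p m"
  shows "image_gen_factor m p =
    gcd q (prime_power_image_gen p (multiplicity p m) * (Carmichael m div Carmichael q))"
  using Carmichael_multiplicity_dvd[OF assms(1,2)]
  by (auto simp: image_gen_factor_def prime_power_image_gen_def q_def Let_def div_mult_swap)

lemma carmichael_quotient_local:
  assumes "m > 0" and "prime p" and "coprime a (int m)"
  defines "q \<equiv> p ^ multiplicity p m"
  shows "gcd (carmichael_quotient m a) (int q) =
    gcd (int (Carmichael m div Carmichael q) * carmichael_quotient q a) (int q)"
proof -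
  define t where "t = Carmichael m div Carmichael q"
  obtain n where n: "m = q * n" "\<not> p dvd n"
    using assms(1,2) multiplicity_decompose'[of m p] unfolding q_def
    by (metis not_gr_zero not_prime_unit)
  have q: "q > 0"
    using assms(1) n(1) by simp
  have "coprime q n"
    using assms(2) n(2) by (simp add: q_def prime_imp_coprime)
  then have coprime: "coprime (int n) (int q)"
    by (simp add: coprime_commute)
  have aq: "coprime a (int q)"
    using assms(3) n(1) by simp
  have t: "Carmichael m = Carmichael q * t"
    using Carmichael_multiplicity_dvd[OF assms(1,2)] by (simp add: t_def q_def)
  let ?y = "int q * carmichael_quotient q a"
  have "1 + int m * carmichael_quotient m a = (a ^ Carmichael q) ^ t"
    using carmichael_quotient_times[OF assms(1,3)] by (simp add: t power_mult)
  also have "a ^ Carmichael q = 1 + ?y"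
    using carmichael_quotient_times[OF q aq] by simp
  \<comment> \<open>The expansion holds modulo \<open>?y\<^sup>2\<close>, a multiple of
    \<open>q^2\<close>. Dividing by \<open>q\<close> below leaves the cofactor \<open>n\<close>, a
    unit modulo \<open>q\<close> that the gcd with \<open>q\<close> does not see.\<close>
  finally have "[1 + int m * carmichael_quotient m a = 1 + int t * ?y] (mod (int q)\<^sup>2)"
    by (metis power_one_plus_cong cong_dvd_modulus dvd_triv_left dvd_power_same)
  then have "(int q)\<^sup>2 dvd int q * (int n * carmichael_quotient m a - int t * carmichael_quotient q a)"
    by (simp add: cong_iff_dvd_diff n(1) algebra_simps)
  then have "[int n * carmichael_quotient m a = int t * carmichael_quotient q a] (mod int q)"
    using q by (simp add: cong_iff_dvd_diff power2_eq_square)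
  then have "gcd (int n * carmichael_quotient m a) (int q) = gcd (int t * carmichael_quotient q a) (int q)"
    by (rule cong_gcd_eq)
  with coprime show ?thesis
    by (simp add: t_def gcd_mult_left_left_cancel coprime_commute)
qed

lemma image_gen_factor_dvd:
  assumes "m > 0" and "p \<in> prime_factors m" and "coprime a (int m)"
  shows "int (image_gen_factor m p) dvd gcd (carmichael_quotient m a) (int (p ^ multiplicity p m))"
proof -
  have p: "prime p" "p dvd m"
    using assms(2) by auto
  then have "coprime a (int p)"
    using assms(3) by (meson coprime_divisors dvd_refl int_dvd_int_iff)
  note e = prime_power_image_gen_dvd[OF p(1) this, of "multiplicity p m"]
  show ?thesis
    unfolding carmichael_quotient_local[OF assms(1) p(1) assms(3)]
      image_gen_factor_eq[OF assms(1) p(1)]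
    using e
    by (auto simp: mult.commute simp flip: gcd_int_int_eq
        intro!: gcd_greatest dvd_trans[OF gcd_dvd2] mult_dvd_mono)
qed

lemma image_gen_factor_attained:
  assumes "m > 0" and "p \<in> prime_factors m" and "coprime a (int m)"
  defines "r \<equiv> multiplicity p m"
  assumes "gcd (int p ^ r) (carmichael_quotient (p ^ r) a) = int (prime_power_image_gen p r)"
  shows "gcd (carmichael_quotient m a) (int (p ^ r)) = int (image_gen_factor m p)"
proof -
  have p: "prime p"
    using assms(2) by auto
  \<comment> \<open>The left side depends on \<open>c\<close> only through \<open>gcd q c\<close>,
    which is all that the assumption on \<open>a\<close> determines.\<close>
  have gcd: "gcd (t * c) q = gcd q (gcd q c * t)" for t c q :: int
  proof (rule zdvd_antisym_nonneg)
    show "gcd (t * c) q dvd gcd q (gcd q c * t)"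
      by (intro gcd_greatest dvd_gcd_mult_int) auto
    have "gcd q c * t dvd t * c"
      by (simp add: mult.commute)
    then show "gcd q (gcd q c * t) dvd gcd (t * c) q"
      by (meson gcd_greatest gcd_dvd1 gcd_dvd2 dvd_trans)
  qed simp_all
  show ?thesis
    unfolding r_def carmichael_quotient_local[OF assms(1) p assms(3)]
      image_gen_factor_eq[OF assms(1) p]
    using assms(5) by (simp add: gcd r_def flip: gcd_int_int_eq)
qed

section \<open>Gluing the primes and computing the image\<close>

lemma carmichael_quotient_power:
  assumes "m > 0" and "coprime a (int m)"
  shows "[carmichael_quotient m (a ^ k) = int k * carmichael_quotient m a] (mod int m)"
proof (induction k)
  case 0
  then show ?case by (simp add: carmichael_quotient_def)
next
  case (Suc k)
  have "[carmichael_quotient m (a * a ^ k) =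
      carmichael_quotient m a + carmichael_quotient m (a ^ k)] (mod int m)"
    using assms by (intro carmichael_quotient_mult) auto
  also have "[carmichael_quotient m a + carmichael_quotient m (a ^ k) =
      carmichael_quotient m a + int k * carmichael_quotient m a] (mod int m)"
    by (intro cong_add cong_refl Suc)
  finally show ?case
    by (simp add: algebra_simps)
qed

lemma gcd_prime_powers:
  assumes "m > 0"
  shows "gcd c (int m) = (\<Prod>p\<in>prime_factors m. gcd c (int (p ^ multiplicity p m)))"
proof -
  have "int m = (\<Prod>p\<in>prime_factors m. int (p ^ multiplicity p m))"
    using prime_factorization_nat[OF assms] by (metis of_nat_prod)
  then show ?thesis
    by (simp only:, intro gcd_prod_coprime_int) (auto intro!: primes_coprime simp: coprime_int_iff)
qed

lemma image_gen_attained: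
  assumes "m > 0"
  obtains x where "coprime x (int m)" "gcd (carmichael_quotient m x) (int m) = int (image_gen m)"
proof -
  let ?q = "\<lambda>p. p ^ multiplicity p m"
  have "\<exists>a. coprime a p \<and> gcd (int (?q p)) (carmichael_quotient (?q p) (int a)) =
      int (prime_power_image_gen p (multiplicity p m))" if "p \<in> prime_factors m" for p
    using that assms prime_power_image_gen_attained[of p "multiplicity p m"]
    by (metis in_prime_factors_iff of_nat_power prime_multiplicity_gt_zero_iff
        prime_imp_prime_elem not_gr_zero)
  then obtain u where u: "\<And>p. p \<in> prime_factors m \<Longrightarrow> coprime (u p) p"
    "\<And>p. p \<in> prime_factors m \<Longrightarrow> gcd (int (?q p)) (carmichael_quotient (?q p) (int (u p))) =
      int (prime_power_image_gen p (multiplicity p m))"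
    by metis
  \<comment> \<open>The moduli are squared because the quotient modulo \<open>?q p\<close> is
    determined by its argument modulo \<open>(?q p)\<^sup>2\<close>.\<close>
  obtain x where x: "\<And>p. p \<in> prime_factors m \<Longrightarrow> [x = u p] (mod (?q p)\<^sup>2)"
    using chinese_remainder_nat[of "prime_factors m" "\<lambda>p. (?q p)\<^sup>2" u]
    by (auto intro!: primes_coprime)
  have uq: "coprime (u p) (?q p)" if "p \<in> prime_factors m" for p
    using u(1)[OF that] by simp
  have xq: "coprime x (?q p)" if "p \<in> prime_factors m" for p
  proof -
    have "[u p = x] (mod ?q p)"
      using x[OF that] by (metis cong_sym cong_dvd_modulus_nat dvd_triv_left power2_eq_square)
    then show ?thesis
      using uq[OF that] cong_imp_coprime by blast
  qed
  then have "coprime x (\<Prod>p\<in>prime_factors m. ?q p)"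
    by (intro prod_coprime_right)
  then have xm: "coprime (int x) (int m)"
    using prime_factorization_nat[OF assms] by simp
  have "gcd (carmichael_quotient m (int x)) (int (?q p)) = int (image_gen_factor m p)"
    if p: "p \<in> prime_factors m" for p
  proof (rule image_gen_factor_attained[OF assms p xm])
    have "[carmichael_quotient (?q p) (int x) = carmichael_quotient (?q p) (int (u p))] (mod int (?q p))"
      using p x[OF p] xq[OF p] prime_gt_0_nat[of p]
      by (intro carmichael_quotient_cong) (auto simp: cong_int_iff simp flip: of_nat_power)
    then show "gcd (int p ^ multiplicity p m) (carmichael_quotient (?q p) (int x)) =
        int (prime_power_image_gen p (multiplicity p m))"
      using u(2)[OF p] cong_gcd_eq by (metis gcd.commute of_nat_power)
  qed
  then have "gcd (carmichael_quotient m (int x)) (int m) = int (image_gen m)"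
    by (simp add: gcd_prime_powers[OF assms] image_gen_def)
  with xm show ?thesis
    using that by blast
qed

lemma image_gen_dvd:
  assumes "m > 0" and "coprime a (int m)"
  shows "int (image_gen m) dvd carmichael_quotient m a"
proof -
  have "int (image_gen m) dvd gcd (carmichael_quotient m a) (int m)"
    unfolding gcd_prime_powers[OF assms(1)] image_gen_def of_nat_prod
    by (intro prod_dvd_prod image_gen_factor_dvd assms)
  then show ?thesis
    by simp
qed

theorem proposition4p3:
  fixes m :: nat
  assumes "m \<ge> 2"
  shows "carmichael_hom m ` carrier (units_of (residue_ring ((int m)\<^sup>2))) =
    (\<lambda>z. z mod int m) ` {z. int (image_gen m) dvd z}"
proof -
  interpret R: residues "(int m)\<^sup>2" "residue_ring ((int m)\<^sup>2)"
    using assms by unfold_locales (simp_all add: one_less_power)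
  have m: "m > 0"
    using assms by simp
  have units: "carrier (units_of (residue_ring ((int m)\<^sup>2))) =
      {x. 0 < x \<and> x < (int m)\<^sup>2 \<and> coprime x (int m)}"
    by (simp add: units_of_def R.res_units_eq)
  show ?thesis
  proof (intro equalityI subsetI)
    fix w assume "w \<in> carmichael_hom m ` carrier (units_of (residue_ring ((int m)\<^sup>2)))"
    then show "w \<in> (\<lambda>z. z mod int m) ` {z. int (image_gen m) dvd z}"
      unfolding units by (auto simp: carmichael_hom_def intro!: imageI image_gen_dvd m)
  next
    fix w assume "w \<in> (\<lambda>z. z mod int m) ` {z. int (image_gen m) dvd z}"
    then obtain z where z: "w = z mod int m" "int (image_gen m) dvd z"
      by blast
    obtain x where x: "coprime x (int m)" "gcd (carmichael_quotient m x) (int m) = int (image_gen m)"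
      using image_gen_attained[OF m] .
    \<comment> \<open>Solvable because the gcd of the coefficient and \<open>m\<close> is
      \<open>image_gen m\<close>, which divides \<open>z\<close>.\<close>
    obtain k where "[carmichael_quotient m x * k = z] (mod int m)"
      using cong_solve_dvd_int[of "carmichael_quotient m x" "int m" z] x(2) z(2) by auto
    \<comment> \<open>\<open>k\<close> may be negative; only its class modulo \<open>m\<close>
      matters, so a natural exponent is available.\<close>
    define j where "j = nat (k mod int m)"
    define y where "y = x ^ j mod (int m)\<^sup>2"
    have y: "[x ^ j = y] (mod (int m)\<^sup>2)"
      by (simp add: y_def)
    have "coprime y ((int m)\<^sup>2)"
      using x(1) y by (metis cong_imp_coprime coprime_power_left_iff coprime_power_right_iff)
    then have "coprime y (int m)"
      by simp
    moreover have "0 \<le> y" "y < (int m)\<^sup>2"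
      using m by (simp_all add: y_def)
    \<comment> \<open>The carrier holds positive representatives; 0 is not coprime to
      \<open>m\<close> since \<open>m \<ge> 2\<close>.\<close>
    moreover have "y \<noteq> 0"
      using \<open>coprime y (int m)\<close> assms by auto
    ultimately have "y \<in> carrier (units_of (residue_ring ((int m)\<^sup>2)))"
      by (simp add: units)
    moreover have "[carmichael_quotient m y = z] (mod int m)"
    proof -
      have "[carmichael_quotient m y = carmichael_quotient m (x ^ j)] (mod int m)"
        using m x(1) y by (intro cong_sym[OF carmichael_quotient_cong]) auto
      also have "[carmichael_quotient m (x ^ j) = int j * carmichael_quotient m x] (mod int m)"
        using m x(1) by (rule carmichael_quotient_power)
      also have "[int j * carmichael_quotient m x = k * carmichael_quotient m x] (mod int m)"
        using m by (intro cong_mult cong_refl) (simp add: j_def)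
      also have "[k * carmichael_quotient m x = z] (mod int m)"
        using \<open>[carmichael_quotient m x * k = z] (mod int m)\<close> by (simp add: mult.commute)
      finally show ?thesis .
    qed
    ultimately show "w \<in> carmichael_hom m ` carrier (units_of (residue_ring ((int m)\<^sup>2)))"
      using z(1) by (intro image_eqI[of _ _ y]) (simp_all add: carmichael_hom_def cong_def)
  qed
qed

end
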